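(* Let $X$ be a non-empty subset of $\mathbb{R}^n$ and let $\succeq$ be a lower semicontinuous relation on $\mathbb{R}^n$. Then $\mathrm{SVIP}(T,X)\subset\mathscr{ME}_{\succeq}(X)$.
   Context: For a binary relation $\succeq$ on $\mathbb{R}^n$, $x\succ y$ means $x\succeq y$ and not $y\succeq x$, and $U^s(x)=\{y\in\mathbb{R}^n : y\succ x\}$. The relation is lower semicontinuous if $U^s(x)$ is open for every $x\in\mathbb{R}^n$. The set of maximal elements of $X$ is $\mathscr{ME}_{\succeq}(X)=\{x\in X : \text{there is no } y\in X \text{ with } y\succ x\}$. The normal cone correspondence is $N(x)=\{x^*\in\mathbb{R}^n : \langle x^*,y-x\rangle\le 0\ \text{for all } y\in U^s(x)\}$ if $U^s(x)\ne\emptyset$, and $N(x)=\mathbb{R}^n$ if $U^s(x)=\emptyset$. The correspondence $T$ is $T(x)=\mathrm{conv}(N(x)\cap S[0,1])$, where $S[0,1]$ is the unit sphere of $\mathbb{R}^n$ and $\mathrm{conv}$ is the convex hull. The solution set of the Stampacchia variational inequality problem, $\mathrm{SVIP}(T,X)$, is the set of $\hat x\in X$ for which there exists $\hat x^*\in T(\hat x)$ with $\langle\hat x^*,y-\hat x\rangle\ge 0$ for all $y\in X$. *)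

theory Defs
  imports "HOL-Analysis.Analysis"
begin

definition strict_part :: "('a \<Rightarrow> 'a \<Rightarrow> bool) \<Rightarrow> 'a \<Rightarrow> 'a \<Rightarrow> bool" where
  "strict_part R x y \<longleftrightarrow> R x y \<and> \<not> R y x"

definition strict_upper_set :: "('a \<Rightarrow> 'a \<Rightarrow> bool) \<Rightarrow> 'a \<Rightarrow> 'a set" where
  "strict_upper_set R x = {y. strict_part R y x}"

definition lower_semicontinuous_rel ::
    "(real ^ 'n \<Rightarrow> real ^ 'n \<Rightarrow> bool) \<Rightarrow> bool" where
  "lower_semicontinuous_rel R \<longleftrightarrow> (\<forall>x. open (strict_upper_set R x))"

definition maximal_elements :: "('a \<Rightarrow> 'a \<Rightarrow> bool) \<Rightarrow> 'a set \<Rightarrow> 'a set" where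
  "maximal_elements R X = {x \<in> X. \<not> (\<exists>y\<in>X. strict_part R y x)}"

definition normal_cone ::
    "(real ^ 'n \<Rightarrow> real ^ 'n \<Rightarrow> bool) \<Rightarrow> real ^ 'n \<Rightarrow> (real ^ 'n) set" where
  "normal_cone R x =
     (if strict_upper_set R x \<noteq> {}
      then {xs. \<forall>y\<in>strict_upper_set R x. inner xs (y - x) \<le> 0}
      else UNIV)"

definition normalized_normal_map ::
    "(real ^ 'n \<Rightarrow> real ^ 'n \<Rightarrow> bool) \<Rightarrow> real ^ 'n \<Rightarrow> (real ^ 'n) set" where
  "normalized_normal_map R x = convex hull (normal_cone R x \<inter> sphere 0 1)"

definition SVIP ::
    "(real ^ 'n \<Rightarrow> (real ^ 'n) set) \<Rightarrow> (real ^ 'n) set \<Rightarrow> (real ^ 'n) set" where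
  "SVIP T X = {x \<in> X. \<exists>xs\<in>T x. \<forall>y\<in>X. inner xs (y - x) \<ge> 0}"

end

theory Submission
  imports Defs
begin

text \<open>An affine function with nonzero linear part that is nonpositive on an open set is negative on it. So if \<open>y \<succ> x\<close>,
  the unit normals at \<open>x\<close> all lie in the open half-space \<open>{c. \<langle>c, y - x\<rangle> < 0}\<close>; this half-space is
  convex and therefore contains \<open>T x\<close>.\<close>

text \<open>Moving from \<open>y\<close> a short way in the direction \<open>c\<close> stays inside
  \<open>U\<close> and strictly increases the functional, so its value at \<open>y\<close> cannot be
  0.\<close>

lemma inner_neg_if_nonpos_on_open:
  fixes c x y :: "'a::real_inner"
  assumes "open U" "y \<in> U" "c \<noteq> 0" and nonpos: "\<And>z. z \<in> U \<Longrightarrow> inner c (z - x) \<le> 0"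
  shows "inner c (y - x) < 0"
proof -
  obtain e where e: "e > 0" "ball y e \<subseteq> U"
    using assms(1,2) open_contains_ball by blast
  \<comment> \<open>This makes \<open>t *\<^sub>R c\<close> a vector of norm \<open>e / 2\<close>,
    short enough to stay in the ball.\<close>
  define t where "t = e / (2 * norm c)"
  have t: "t > 0" "norm (t *\<^sub>R c) < e"
    using e(1) \<open>c \<noteq> 0\<close> by (auto simp: t_def)
  have "y + t *\<^sub>R c \<in> U"
    using e(2) t(2) by (auto simp: dist_norm)
  then have "inner c (y + t *\<^sub>R c - x) \<le> 0"
    by (rule nonpos)
  then have "inner c (y - x) + t * inner c c \<le> 0"
    by (simp add: inner_add_right inner_diff_right)
  moreover have "t * inner c c > 0"
    using t(1) \<open>c \<noteq> 0\<close> by simp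
  ultimately show ?thesis by linarith
qed

lemma normalized_normal_map_inner_neg:
  fixes R :: "real ^ 'n \<Rightarrow> real ^ 'n \<Rightarrow> bool"
  assumes "open (strict_upper_set R x)" "strict_part R y x" "c \<in> normalized_normal_map R x"
  shows "inner c (y - x) < 0"
proof -
  have y: "y \<in> strict_upper_set R x"
    using assms(2) by (simp add: strict_upper_set_def)
  have "normal_cone R x \<inter> sphere 0 1 \<subseteq> {c. inner (y - x) c < 0}"
  proof
    fix c assume c: "c \<in> normal_cone R x \<inter> sphere 0 1"
    have "inner c (y - x) < 0"
    proof (rule inner_neg_if_nonpos_on_open[OF assms(1) y])
      \<comment> \<open>Normalization enters here: 0 lies in every normal cone, but not on the unit
        sphere.\<close>
      show "c \<noteq> 0" using c by auto
      show "inner c (z - x) \<le> 0" if "z \<in> strict_upper_set R x" for z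
        using c that by (auto simp: normal_cone_def split: if_splits)
    qed
    then show "c \<in> {c. inner (y - x) c < 0}" by (simp add: inner_commute)
  qed
  then have "normalized_normal_map R x \<subseteq> {c. inner (y - x) c < 0}"
    unfolding normalized_normal_map_def by (rule hull_minimal) (rule convex_halfspace_lt)
  with assms(3) show ?thesis by (auto simp: inner_commute)
qed

theorem proposition3p11:
  fixes R :: "real ^ 'n \<Rightarrow> real ^ 'n \<Rightarrow> bool"
    and X :: "(real ^ 'n) set"
  assumes "X \<noteq> {}"
    and "lower_semicontinuous_rel R"
  shows "SVIP (normalized_normal_map R) X \<subseteq> maximal_elements R X"
proof
  fix x assume "x \<in> SVIP (normalized_normal_map R) X"
  then obtain c where "x \<in> X" and c: "c \<in> normalized_normal_map R x"
    and nonneg: "\<And>y. y \<in> X \<Longrightarrow> inner c (y - x) \<ge> 0"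
    by (auto simp: SVIP_def)
  have "open (strict_upper_set R x)"
    using assms(2) by (simp add: lower_semicontinuous_rel_def)
  \<comment> \<open>A \<open>y\<close> in \<open>X\<close> strictly preferred to \<open>x\<close>
    would make \<open>inner c (y - x)\<close> negative, against the variational inequality.\<close>
  then have "\<not> strict_part R y x" if "y \<in> X" for y
    using normalized_normal_map_inner_neg c nonneg[OF that] by fastforce
  with \<open>x \<in> X\<close> show "x \<in> maximal_elements R X"
    by (auto simp: maximal_elements_def)
qed

end
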